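(* Let $X$ be a compact metric space and let $\mathcal{F}=\{f_1,\dots,f_k\}$ be a finite family of homeomorphisms of $X$. If $\mathcal{F}$ is backward minimal and has a repelling fixed point, then $\mathcal{F}$ is topologically exact.
   Context: $\mathcal{F}^+$ denotes the semigroup generated by $f_1,\dots,f_k$ under composition. A non-empty subset $A\subset X$ is backward invariant for $\mathcal{F}$ if $\emptyset\neq f^{-1}(A)\subseteq A$ for all $f\in\mathcal{F}^+$. $\mathcal{F}$ is backward minimal if the only non-empty closed backward invariant set is $X$. $\mathcal{F}$ has a repelling fixed point if some $f\in\mathcal{F}$ has a repelling fixed point $p$, i.e. $f(p)=p$ and $p$ is an attracting fixed point of $f^{-1}$: there is an open neighbourhood $V$ of $p$ with $f^{-1}(\overline{V})\subset V$ and $\bigcap_{n\ge0}f^{-n}(V)=\{p\}$. Put $\widetilde F(A)=\bigcup_{i=1}^k f_i(A)$ for $A\subset X$. $\mathcal{F}$ is topologically exact if for every non-empty open $U\subset X$ there is $n\in\mathbb{N}$ with $\widetilde F^n(U)=X$. *)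

theory Defs
  imports "HOL-Analysis.Analysis"
begin

text \<open>
  The space \<open>X\<close> is a topology \<open>T\<close> with carrier \<open>topspace T\<close>. Maps of \<open>X\<close> are
  total functions on the ambient type, so preimages are cut down to the carrier and only the
  values of a map on \<open>topspace T\<close> matter.
\<close>

definition preimage_in :: "'a topology \<Rightarrow> ('a \<Rightarrow> 'a) \<Rightarrow> 'a set \<Rightarrow> 'a set" where
  "preimage_in T f A = {x \<in> topspace T. f x \<in> A}"

text \<open>Only non-empty words in the generators are included; the identity is not adjoined.\<close>

inductive_set generated_semigroup :: "('a \<Rightarrow> 'a) set \<Rightarrow> ('a \<Rightarrow> 'a) set"
  for F :: "('a \<Rightarrow> 'a) set" where
  generator: "f \<in> F \<Longrightarrow> f \<in> generated_semigroup F"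
| compose: "g \<in> generated_semigroup F \<Longrightarrow> h \<in> generated_semigroup F
    \<Longrightarrow> g \<circ> h \<in> generated_semigroup F"

definition backward_invariant :: "'a topology \<Rightarrow> ('a \<Rightarrow> 'a) set \<Rightarrow> 'a set \<Rightarrow> bool" where
  "backward_invariant T F A \<longleftrightarrow>
     A \<noteq> {} \<and> A \<subseteq> topspace T \<and>
     (\<forall>f \<in> generated_semigroup F. preimage_in T f A \<noteq> {} \<and> preimage_in T f A \<subseteq> A)"

definition backward_minimal :: "'a topology \<Rightarrow> ('a \<Rightarrow> 'a) set \<Rightarrow> bool" where
  "backward_minimal T F \<longleftrightarrow>
     (\<forall>A. closedin T A \<and> backward_invariant T F A \<longrightarrow> A = topspace T)"

definition repelling_fixed_point :: "'a topology \<Rightarrow> ('a \<Rightarrow> 'a) \<Rightarrow> 'a \<Rightarrow> bool" where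
  "repelling_fixed_point T f p \<longleftrightarrow>
     p \<in> topspace T \<and> f p = p \<and>
     (\<exists>V. openin T V \<and> p \<in> V \<and>
          preimage_in T f (T closure_of V) \<subseteq> V \<and>
          (\<Inter>n. preimage_in T (f ^^ n) V) = {p})"

text \<open>
  The map with the repelling fixed point is one of the generators, not an arbitrary element of
  the generated semigroup: the swap of a two-point discrete space is backward minimal and its
  square has a repelling fixed point, but the swap alone is not topologically exact.
\<close>

definition has_repelling_fixed_point :: "'a topology \<Rightarrow> ('a \<Rightarrow> 'a) set \<Rightarrow> bool" where
  "has_repelling_fixed_point T F \<longleftrightarrow> (\<exists>f \<in> F. \<exists>p. repelling_fixed_point T f p)"

definition image_union :: "('a \<Rightarrow> 'a) set \<Rightarrow> 'a set \<Rightarrow> 'a set" where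
  "image_union F A = (\<Union>f \<in> F. f ` A)"

text \<open>
  The exponent is taken to be positive. For a non-empty family of surjections of the carrier
  this agrees with allowing exponent zero.
\<close>

definition topologically_exact :: "'a topology \<Rightarrow> ('a \<Rightarrow> 'a) set \<Rightarrow> bool" where
  "topologically_exact T F \<longleftrightarrow>
     (\<forall>U. openin T U \<and> U \<noteq> {} \<longrightarrow> (\<exists>n>0. (image_union F ^^ n) U = topspace T))"

end

theory Submission
  imports Defs
begin

text \<open>
  By backward minimality every backward orbit is dense. Write \<open>\<Phi>\<close> for \<open>image_union F\<close> and let \<open>p\<close>
  be the repelling fixed point of \<open>f \<in> F\<close>, with neighbourhood \<open>V\<close>. Density of the backward orbit
  of \<open>p\<close> gives \<open>p \<in> g(U)\<close> for some word \<open>g\<close>, and by compactness \<open>f\<^sup>-\<^sup>n(V) \<subseteq> g(U)\<close> for large \<open>n\<close>,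
  so some iterate of \<open>\<Phi>\<close> maps \<open>U\<close> onto a superset of \<open>V\<close>. Density of all backward orbits shows that
  the sets \<open>\<Phi>\<^sup>n(V)\<close> cover the space; they increase with \<open>n\<close> because \<open>V \<subseteq> f(V)\<close>, hence by
  compactness one of them is everything.
\<close>

section \<open>Iterates of the union map\<close>

lemma image_union_funpow_mono:
  assumes "A \<subseteq> B"
  shows "(image_union F ^^ n) A \<subseteq> (image_union F ^^ n) B"
proof -
  have "mono (image_union F)"
    unfolding image_union_def by (intro monoI) blast
  then show ?thesis
    using assms by (rule funpow_mono)
qed

lemma funpow_image_subset_image_union:
  assumes "f \<in> F"
  shows "(f ^^ n) ` A \<subseteq> (image_union F ^^ n) A"
proof (induction n)
  case (Suc n)
  have "(f ^^ Suc n) ` A = f ` ((f ^^ n) ` A)"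
    by (simp add: image_comp)
  also have "\<dots> \<subseteq> image_union F ((image_union F ^^ n) A)"
    using Suc assms unfolding image_union_def by blast
  finally show ?case
    by simp
qed simp

lemma generated_semigroup_image_subset_image_union:
  assumes "g \<in> generated_semigroup F"
  shows "\<exists>n>0. \<forall>A. g ` A \<subseteq> (image_union F ^^ n) A"
  using assms
proof induction
  case (generator f)
  then have "\<forall>A. f ` A \<subseteq> (image_union F ^^ 1) A"
    by (auto simp: image_union_def)
  then show ?case
    using zero_less_one by blast
next
  case (compose g h)
  obtain m where m: "m > 0" and g: "\<And>A. g ` A \<subseteq> (image_union F ^^ m) A"
    using compose.IH(1) by auto
  obtain n where h: "\<And>A. h ` A \<subseteq> (image_union F ^^ n) A"
    using compose.IH(2) by auto
  have "(g \<circ> h) ` A \<subseteq> (image_union F ^^ (m + n)) A" for A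
  proof -
    have "(g \<circ> h) ` A \<subseteq> (image_union F ^^ m) (h ` A)"
      using g [of "h ` A"] by (simp add: image_comp)
    also have "\<dots> \<subseteq> (image_union F ^^ m) ((image_union F ^^ n) A)"
      by (rule image_union_funpow_mono [OF h])
    finally show ?thesis
      by (simp add: funpow_add)
  qed
  then show ?case
    using m by (intro exI [of _ "m + n"]) simp
qed

lemma image_union_funpow_incseq:
  assumes "A \<subseteq> image_union F A"
  shows "incseq (\<lambda>n. (image_union F ^^ n) A)"
proof (rule incseq_SucI)
  show "(image_union F ^^ n) A \<subseteq> (image_union F ^^ Suc n) A" for n
    using image_union_funpow_mono [OF assms] by (simp add: funpow_swap1)
qed

lemma openin_image_union_funpow:
  assumes "\<And>f. f \<in> F \<Longrightarrow> open_map T T f" "openin T U"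
  shows "openin T ((image_union F ^^ n) U)"
proof (induction n)
  case (Suc n)
  then show ?case
    using assms(1) by (auto simp: image_union_def open_map_def)
qed (simp add: assms)

section \<open>Words as homeomorphisms and density of backward orbits\<close>

lemma homeomorphic_map_generated_semigroup:
  assumes "\<And>f. f \<in> F \<Longrightarrow> homeomorphic_map T T f" "g \<in> generated_semigroup F"
  shows "homeomorphic_map T T g"
  using assms(2)
  by induction (use assms(1) homeomorphic_map_compose in blast)+

lemma homeomorphic_map_funpow:
  assumes "homeomorphic_map T T f"
  shows "homeomorphic_map T T (f ^^ n)"
proof (induction n)
  case 0
  then show ?case
    using homeomorphic_map_id [of T T] by (simp add: id_def)
next
  case (Suc n)
  then show ?case
    using homeomorphic_map_compose [OF Suc assms] by (simp only: funpow.simps)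
qed

text \<open>The closure of the backward orbit of \<open>x\<close> is closed and backward invariant,
  so by minimality it is the whole space. An orbit point inside \<open>U\<close> is then carried to
  \<open>x\<close> by some word.\<close>

lemma backward_orbit_dense:
  assumes hom: "\<And>f. f \<in> F \<Longrightarrow> homeomorphic_map T T f"
    and "F \<noteq> {}" and min: "backward_minimal T F"
    and x: "x \<in> topspace T" and U: "openin T U" "U \<noteq> {}"
  obtains g where "g \<in> generated_semigroup F" "x \<in> g ` U"
proof -
  define B where "B = {y \<in> topspace T. \<exists>g \<in> generated_semigroup F. g y = x}"
  have homS: "homeomorphic_map T T h" if "h \<in> generated_semigroup F" for h
    using hom that by (rule homeomorphic_map_generated_semigroup)
  have surj: "\<exists>x \<in> topspace T. h x = y"
    if "h \<in> generated_semigroup F" "y \<in> topspace T" for h y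
    using homeomorphic_imp_surjective_map [OF homS [OF that(1)]] that(2) by (metis imageE)
  \<comment> \<open>The semigroup need not contain the identity, so \<open>x\<close> itself may lie
    outside \<open>B\<close>; a preimage of \<open>x\<close> under a generator shows that
    \<open>B\<close> is non-empty.\<close>
  obtain f where "f \<in> generated_semigroup F"
    using \<open>F \<noteq> {}\<close> generated_semigroup.generator by blast
  then have "B \<noteq> {}"
    using surj [OF _ x] unfolding B_def by blast
  moreover have "B \<subseteq> topspace T"
    unfolding B_def by blast
  ultimately have ne: "T closure_of B \<noteq> {}"
    using closure_of_subset by blast
  have "backward_invariant T F (T closure_of B)"
    unfolding backward_invariant_def
  proof (intro conjI ballI)
    fix h assume h: "h \<in> generated_semigroup F"
    show "preimage_in T h (T closure_of B) \<noteq> {}"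
    proof -
      obtain b where b: "b \<in> T closure_of B"
        using ne by blast
      then have "\<exists>x \<in> topspace T. h x = b"
        using surj [OF h] by (simp add: in_closure_of)
      then show ?thesis
        using b unfolding preimage_in_def by auto
    qed
    show "preimage_in T h (T closure_of B) \<subseteq> T closure_of B"
    proof
      fix y assume "y \<in> preimage_in T h (T closure_of B)"
      then have y: "y \<in> topspace T" "h y \<in> T closure_of B"
        by (auto simp: preimage_in_def)
      have "\<exists>w. w \<in> B \<and> w \<in> W" if W: "y \<in> W" "openin T W" for W
      proof -
        have "openin T (h ` W)"
          using homeomorphic_imp_open_map [OF homS [OF h]] W(2) by (simp add: open_map_def)
        moreover have "h y \<in> h ` W"
          using W(1) by (rule imageI)
        ultimately obtain z where "z \<in> B" "z \<in> h ` W"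
          using y(2) by (metis in_closure_of)
        then obtain w where w: "w \<in> W" "h w \<in> B"
          by (metis imageE)
        then obtain g where g: "g \<in> generated_semigroup F" "(g \<circ> h) w = x"
          unfolding B_def by auto
        have "w \<in> topspace T"
          using w(1) openin_subset [OF W(2)] by (rule rev_subsetD)
        moreover have "g \<circ> h \<in> generated_semigroup F"
          using g(1) h by (rule generated_semigroup.compose)
        ultimately have "w \<in> B"
          using g(2) unfolding B_def by blast
        with w show ?thesis
          by blast
      qed
      then show "y \<in> T closure_of B"
        using y(1) by (simp add: in_closure_of)
    qed
  qed (rule ne, rule closure_of_subset_topspace)
  then have "T closure_of B = topspace T"
    using min unfolding backward_minimal_def by auto
  moreover obtain u where u: "u \<in> U" "u \<in> topspace T"
    using U openin_subset by blast
  ultimately have "u \<in> T closure_of B"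
    by simp
  then obtain v where "v \<in> B" "v \<in> U"
    using U(1) u(1) by (metis in_closure_of)
  then obtain g where "g \<in> generated_semigroup F" "g v = x"
    unfolding B_def by auto
  with \<open>v \<in> U\<close> show ?thesis
    using that by (metis imageI)
qed

section \<open>Compactness arguments\<close>

text \<open>If every preimage of \<open>V\<close> left \<open>G\<close>, the preimages of the
  closure of \<open>V\<close>, with \<open>G\<close> removed, would be nested non-empty closed sets.
  A common point would lie in every preimage of \<open>V\<close>, hence equal \<open>p\<close>,
  although \<open>p\<close> is in \<open>G\<close>.\<close>

lemma repelling_funpow_preimage_subset:
  assumes "compact_space T" and hom: "homeomorphic_map T T f"
    and inv: "preimage_in T f (T closure_of V) \<subseteq> V"
    and "openin T V"
    and int: "(\<Inter>n. preimage_in T (f ^^ n) V) = {p}"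
    and G: "openin T G" "p \<in> G"
  shows "\<exists>n. preimage_in T (f ^^ n) V \<subseteq> G"
proof (rule ccontr)
  assume neg: "\<nexists>n. preimage_in T (f ^^ n) V \<subseteq> G"
  define K where "K n = preimage_in T (f ^^ n) (T closure_of V)" for n
  have V_sub: "V \<subseteq> T closure_of V"
    using \<open>openin T V\<close> by (simp add: closure_of_subset openin_subset)
  have homn: "homeomorphic_map T T (f ^^ n)" for n
    using hom by (rule homeomorphic_map_funpow)
  \<comment> \<open>With \<open>K_sup\<close> this interleaves the closed sets \<open>K n\<close>
    with the preimages of \<open>V\<close>: the \<open>K n\<close> decrease and both families have
    the same intersection.\<close>
  have K_Suc: "K (Suc n) \<subseteq> preimage_in T (f ^^ n) V" for n
  proof
    fix x assume "x \<in> K (Suc n)"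
    then have "x \<in> topspace T" "f ((f ^^ n) x) \<in> T closure_of V"
      by (auto simp: K_def preimage_in_def)
    moreover have "(f ^^ n) x \<in> topspace T"
      using homn [of n] \<open>x \<in> topspace T\<close> homeomorphic_imp_surjective_map by blast
    ultimately show "x \<in> preimage_in T (f ^^ n) V"
      using inv by (auto simp: preimage_in_def)
  qed
  have K_sup: "preimage_in T (f ^^ n) V \<subseteq> K n" for n
    using V_sub by (auto simp: K_def preimage_in_def)
  have "closedin T (K n)" for n
    using closedin_continuous_map_preimage
      [OF homeomorphic_imp_continuous_map [OF homn] closedin_closure_of]
    by (simp add: K_def preimage_in_def)
  then have "closedin T (K n - G)" for n
    using G(1) by (simp add: closedin_diff)
  moreover have "K n - G \<noteq> {}" for n
    using neg K_sup by blast
  moreover have "decseq (\<lambda>n. K n - G)"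
    using K_Suc K_sup by (intro decseq_SucI) blast
  ultimately have "(\<Inter>n. K n - G) \<noteq> {}"
    using compact_space_imp_nest [OF \<open>compact_space T\<close>, of "\<lambda>n. K n - G"] by blast
  then obtain x where x: "x \<notin> G" "\<And>n. x \<in> K n"
    by auto
  then have "x \<in> (\<Inter>n. preimage_in T (f ^^ n) V)"
    using K_Suc by blast
  then show False
    using x(1) int G(2) by simp
qed

lemma compact_space_incseq_cover:
  assumes "compact_space T" "\<And>n. openin T (U n)" "incseq U" "topspace T \<subseteq> (\<Union>n. U n)"
  shows "\<exists>n. U n = topspace T"
proof (rule ccontr)
  assume "\<nexists>n. U n = topspace T"
  then have "topspace T - U n \<noteq> {}" for n
    using assms(2) openin_subset by blast
  moreover have "decseq (\<lambda>n. topspace T - U n)"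
    using \<open>incseq U\<close> by (auto simp: monotone_def)
  moreover have "closedin T (topspace T - U n)" for n
    using assms(2) by blast
  ultimately have "(\<Inter>n. topspace T - U n) \<noteq> {}"
    using \<open>compact_space T\<close> compact_space_imp_nest [of T "\<lambda>n. topspace T - U n"] by blast
  then show False
    using assms(4) by blast
qed

section \<open>From density and repulsion to exactness\<close>

lemma backward_minimal_repelling_imp_topologically_exact:
  assumes "compact_space T"
    and hom: "\<And>f. f \<in> F \<Longrightarrow> homeomorphic_map T T f"
    and min: "backward_minimal T F"
    and rep: "has_repelling_fixed_point T F"
  shows "topologically_exact T F"
  unfolding topologically_exact_def
proof (intro allI impI)
  fix U assume "openin T U \<and> U \<noteq> {}"
  then have U: "openin T U" "U \<noteq> {}"
    by auto
  obtain f p V where f: "f \<in> F" and p: "p \<in> topspace T"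
    and V: "openin T V" "p \<in> V" "preimage_in T f (T closure_of V) \<subseteq> V"
      "(\<Inter>n. preimage_in T (f ^^ n) V) = {p}"
    using rep unfolding has_repelling_fixed_point_def repelling_fixed_point_def by auto
  have "F \<noteq> {}"
    using f by blast
  have dense: "\<exists>g \<in> generated_semigroup F. x \<in> g ` W"
    if "x \<in> topspace T" "openin T W" "W \<noteq> {}" for x W
    using backward_orbit_dense [OF hom \<open>F \<noteq> {}\<close> min that] by blast
  have subset_image: "A \<subseteq> (f ^^ n) ` preimage_in T (f ^^ n) A" if "A \<subseteq> topspace T" for A n
  proof -
    have "(f ^^ n) ` topspace T = topspace T"
      using homeomorphic_map_funpow [OF hom [OF f]] by (simp add: homeomorphic_imp_surjective_map)
    then have "\<exists>x \<in> topspace T. y = (f ^^ n) x" if "y \<in> A" for y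
      using \<open>A \<subseteq> topspace T\<close> that by (metis imageE subsetD)
    then show ?thesis
      by (fastforce simp: preimage_in_def)
  qed
  have V_top: "V \<subseteq> topspace T"
    using V(1) by (rule openin_subset)

  obtain g where g: "g \<in> generated_semigroup F" "p \<in> g ` U"
    using dense [OF p U] by blast
  have "openin T (g ` U)"
    using homeomorphic_map_generated_semigroup [OF _ g(1)] hom U(1)
      homeomorphic_imp_open_map open_map_def by metis
  then obtain n where n: "preimage_in T (f ^^ n) V \<subseteq> g ` U"
    using repelling_funpow_preimage_subset [OF assms(1) hom [OF f] V(3,1,4)] g(2) by blast
  obtain m where m: "m > 0" "g ` U \<subseteq> (image_union F ^^ m) U"
    using generated_semigroup_image_subset_image_union [OF g(1)] by blast
  have "V \<subseteq> (f ^^ n) ` (g ` U)"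
    using subset_image [OF V_top, of n] n by blast
  also have "\<dots> \<subseteq> (image_union F ^^ n) (g ` U)"
    by (rule funpow_image_subset_image_union [OF f])
  also have "\<dots> \<subseteq> (image_union F ^^ n) ((image_union F ^^ m) U)"
    by (rule image_union_funpow_mono [OF m(2)])
  finally have reach: "V \<subseteq> (image_union F ^^ (n + m)) U"
    by (simp add: funpow_add)

  have "preimage_in T f V \<subseteq> V"
    using V(3) closure_of_subset [OF V_top] unfolding preimage_in_def by blast
  then have "f ` preimage_in T f V \<subseteq> f ` V"
    by (rule image_mono)
  then have "V \<subseteq> f ` V"
    using subset_image [OF V_top, of 1] by simp
  also have "\<dots> \<subseteq> image_union F V"
    using f unfolding image_union_def by (rule UN_upper)
  finally have "incseq (\<lambda>k. (image_union F ^^ k) V)"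
    by (rule image_union_funpow_incseq)
  moreover have openU: "openin T ((image_union F ^^ k) W)" if "openin T W" for k W
    using hom that by (intro openin_image_union_funpow homeomorphic_imp_open_map)
  \<comment> \<open>Density is used a second time, now for the backward orbit of an arbitrary point,
    which has to enter \<open>V\<close>.\<close>
  moreover have "topspace T \<subseteq> (\<Union>k. (image_union F ^^ k) V)"
  proof
    fix x assume "x \<in> topspace T"
    then obtain h where h: "h \<in> generated_semigroup F" "x \<in> h ` V"
      using dense V(1,2) by blast
    then show "x \<in> (\<Union>k. (image_union F ^^ k) V)"
      using generated_semigroup_image_subset_image_union [OF h(1)] by blast
  qed
  ultimately obtain k where k: "(image_union F ^^ k) V = topspace T"
    using compact_space_incseq_cover [OF assms(1), of "\<lambda>k. (image_union F ^^ k) V"] V(1) by blast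

  have "topspace T \<subseteq> (image_union F ^^ (k + (n + m))) U"
    using image_union_funpow_mono [OF reach, where F = F and n = k] k by (simp add: funpow_add)
  then have "(image_union F ^^ (k + (n + m))) U = topspace T"
    using openin_subset [OF openU [OF U(1)]] by blast
  \<comment> \<open>Both \<open>k\<close> and \<open>n\<close> may be zero; the exponent is positive
    because \<open>m\<close> is.\<close>
  then show "\<exists>n>0. (image_union F ^^ n) U = topspace T"
    using m(1) by (intro exI [of _ "k + (n + m)"]) simp
qed

theorem theorem4:
  fixes X :: "'a set" and d :: "'a \<Rightarrow> 'a \<Rightarrow> real" and F :: "('a \<Rightarrow> 'a) set"
  assumes "Metric_space X d"
    and "compact_space (Metric_space.mtopology X d)"
    and "finite F"
    and "\<And>f. f \<in> F \<Longrightarrow>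
           homeomorphic_map (Metric_space.mtopology X d) (Metric_space.mtopology X d) f"
    and "backward_minimal (Metric_space.mtopology X d) F"
    and "has_repelling_fixed_point (Metric_space.mtopology X d) F"
  shows "topologically_exact (Metric_space.mtopology X d) F"
  using assms(2,4-6) by (rule backward_minimal_repelling_imp_topologically_exact)

end
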